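(* Let $\mathbb{K}$ be an infinite field with $\mathrm{char}\,\mathbb{K}=2$, let $r$ and $d$ be integers with $5\le d\le r$, and let $\alpha_1,\dots,\alpha_r$ be integers with $2\le \alpha_i\le 4$ for all $1\le i\le r$. Let $R=\mathbb{K}[x_1,\dots,x_r]$ and let $$I=(x_1^{\alpha_1},\dots,x_r^{\alpha_r})+(\text{all squarefree monomials of degree } d)\subset R.$$ Then $A=R/I$ does not have the weak Lefschetz property.
   Context: The ring $R=\mathbb{K}[x_1,\dots,x_r]$ has the standard grading. A standard graded Artinian $\mathbb{K}$-algebra $A=R/I=\bigoplus_{i=0}^e A_i$ (with $I$ a homogeneous ideal, $A_e\neq 0$) has the weak Lefschetz property (WLP) if there exists a linear form $\ell\in R_1$ such that for every $0\le i\le e-1$ the multiplication map $\times\ell: A_i\to A_{i+1}$ has maximal rank, i.e. is injective or surjective. *)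

theory Defs
  imports
    "HOL-Library.Poly_Mapping"
    "HOL-Library.Cardinality"
    "HOL-Algebra.QuotRing"
    "HOL-Algebra.Algebraic_Closure_Type"
begin

text \<open>
  The polynomial ring over \<open>'k\<close> with one variable for each element of the finite type \<open>'n\<close>:
  a polynomial is a finitely supported map from exponent vectors to coefficients.
\<close>

type_synonym ('n, 'k) mpoly = "('n \<Rightarrow>\<^sub>0 nat) \<Rightarrow>\<^sub>0 'k"

abbreviation mpoly_ring :: "('n::finite, 'k::field) mpoly ring" where
  "mpoly_ring \<equiv> ring_of_type_algebra"

definition monomial :: "('n::finite \<Rightarrow>\<^sub>0 nat) \<Rightarrow> ('n, 'k::field) mpoly" where
  "monomial m = Poly_Mapping.single m 1"

definition indet :: "'n::finite \<Rightarrow> ('n, 'k::field) mpoly" where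
  "indet i = monomial (Poly_Mapping.single i 1)"

definition mon_deg :: "('n::finite \<Rightarrow>\<^sub>0 nat) \<Rightarrow> nat" where
  "mon_deg m = (\<Sum>i\<in>UNIV. Poly_Mapping.lookup m i)"

definition squarefree_mon :: "('n::finite \<Rightarrow>\<^sub>0 nat) \<Rightarrow> bool" where
  "squarefree_mon m \<longleftrightarrow> (\<forall>i. Poly_Mapping.lookup m i \<le> 1)"

definition homogeneous_part :: "nat \<Rightarrow> ('n::finite, 'k::field) mpoly set" where
  "homogeneous_part i = {f. \<forall>m\<in>Poly_Mapping.keys f. mon_deg m = i}"

text \<open>
  For a homogeneous ideal \<open>I\<close>, the degree \<open>i\<close> component of the quotient by \<open>I\<close> is the image of
  the degree \<open>i\<close> forms.  Its elements are cosets of \<open>I\<close>, and its zero element is \<open>I\<close> itself.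
\<close>

definition quot_part ::
    "('n::finite, 'k::field) mpoly set \<Rightarrow> nat \<Rightarrow> ('n, 'k) mpoly set set" where
  "quot_part I i = (\<lambda>f. I +>\<^bsub>mpoly_ring\<^esub> f) ` homogeneous_part i"

text \<open>
  The largest degree in which the quotient is nonzero.  It is meaningful only if the quotient is
  nonzero and Artinian, that is, if the set of degrees \<open>i\<close> in question is nonempty and bounded.
\<close>

definition top_degree :: "('n::finite, 'k::field) mpoly set \<Rightarrow> nat" where
  "top_degree I = (GREATEST i. quot_part I i \<noteq> {\<zero>\<^bsub>mpoly_ring Quot I\<^esub>})"

definition mult_map ::
    "('n::finite, 'k::field) mpoly set \<Rightarrow> ('n, 'k) mpoly \<Rightarrow> ('n, 'k) mpoly set \<Rightarrow> ('n, 'k) mpoly set"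
  where "mult_map I l c = (I +>\<^bsub>mpoly_ring\<^esub> l) \<otimes>\<^bsub>mpoly_ring Quot I\<^esub> c"

definition weak_Lefschetz :: "('n::finite, 'k::field) mpoly set \<Rightarrow> bool" where
  "weak_Lefschetz I \<longleftrightarrow>
     (\<exists>l\<in>homogeneous_part 1. \<forall>i<top_degree I.
        inj_on (mult_map I l) (quot_part I i) \<or>
        mult_map I l ` quot_part I i = quot_part I (i + 1))"

definition powers_squarefree_ideal ::
    "('n::finite \<Rightarrow> nat) \<Rightarrow> nat \<Rightarrow> ('n, 'k::field) mpoly set" where
  "powers_squarefree_ideal \<alpha> d =
     Idl\<^bsub>mpoly_ring\<^esub> (range (\<lambda>i. indet i ^ \<alpha> i) \<union>
                    {monomial m | m. squarefree_mon m \<and> mon_deg m = d})"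

end

theory Submission
  imports Defs "HOL-Computational_Algebra.Primes"
begin

text \<open>
  Let \<open>l = \<Sum>i. a\<^sub>i x\<^sub>i\<close> be any linear form.  In characteristic 2 one has
  \<open>l\<^sup>4 = \<Sum>i. a\<^sub>i\<^sup>4 x\<^sub>i\<^sup>4\<close>, and this lies in \<open>I\<close> because every \<open>\<alpha> i\<close> is at most 4.  Hence the maps
  \<open>\<times>l : A\<^sub>i \<rightarrow> A\<^sub>i\<^sub>+\<^sub>1\<close> cannot be injective for all of \<open>i = 0, 1, 2, 3\<close>: otherwise
  \<open>l\<^sup>4 = 0\<close> in \<open>A\<close> would give \<open>l\<^sup>3 = 0\<close>, and so on down to \<open>1 = 0\<close>
  (\<open>linear_form_power4_in_ideal\<close>).

  On the other hand none of these four maps is surjective (\<open>multiplication_not_surjective\<close>).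
  For a set \<open>U\<close> of \<open>j + 1\<close> variables, where \<open>j = i + 1\<close>, consider the linear functional
  \<open>g \<mapsto> \<Sum>u\<in>U. a\<^sub>u [x\<^bsup>U - u\<^esup>] g\<close>.  It reads only coefficients of squarefree monomials of degree
  \<open>j < d\<close>, none of which occurs in an element of \<open>I\<close>; it kills every multiple of \<open>l\<close>, because
  the coefficient of \<open>x\<^bsup>U - u - v\<^esup>\<close> enters twice, both times with the factor \<open>a\<^sub>u a\<^sub>v\<close>; and it
  is nonzero on \<open>x\<^bsup>U - w\<^esup>\<close> for \<open>w \<in> U\<close> with \<open>a\<^sub>w \<noteq> 0\<close>.  (For \<open>l = 0\<close> it is enough that
  \<open>A\<close> is nonzero in degree \<open>j\<close>.)  The bound \<open>5 \<le> d \<le> CARD('n)\<close> is what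
  provides the set \<open>U\<close> and the inequality \<open>j < d\<close> for all \<open>j \<le> 4\<close>; it also makes \<open>A\<close> nonzero in
  degree 4, so that all four maps are subject to the weak Lefschetz property.
\<close>

section \<open>Quotients of the polynomial ring\<close>

lemma carrier_mpoly_ring [simp]: "carrier mpoly_ring = UNIV"
  and mult_mpoly_ring [simp]: "x \<otimes>\<^bsub>mpoly_ring\<^esub> y = x * y"
  and add_mpoly_ring [simp]: "x \<oplus>\<^bsub>mpoly_ring\<^esub> y = x + y"
  and zero_mpoly_ring [simp]: "\<zero>\<^bsub>mpoly_ring\<^esub> = 0"
  by (simp_all add: ring_of_type_algebra_def)

lemma a_inv_mpoly_ring [simp]:
  "\<ominus>\<^bsub>mpoly_ring\<^esub> x = - (x :: ('n::finite, 'k::field) mpoly)"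
proof -
  interpret ring "mpoly_ring :: ('n, 'k) mpoly ring" ..
  show ?thesis
    using minus_equality[of "- x" x] by simp
qed

lemma coset_eq_iff:
  fixes I :: "('n::finite, 'k::field) mpoly set"
  assumes "ideal I mpoly_ring"
  shows "I +>\<^bsub>mpoly_ring\<^esub> f = I +>\<^bsub>mpoly_ring\<^esub> g \<longleftrightarrow> f - g \<in> I"
proof -
  interpret ideal I "mpoly_ring :: ('n, 'k) mpoly ring" by fact
  show ?thesis
    using quotient_eq_iff_same_a_r_cos[OF assms, of f g]
    by (simp add: a_minus_def)
qed

lemma coset_zero:
  fixes I :: "('n::finite, 'k::field) mpoly set"
  shows "I +>\<^bsub>mpoly_ring\<^esub> 0 = I"
  by (simp add: a_r_coset_def')

lemma mult_map_coset:
  fixes I :: "('n::finite, 'k::field) mpoly set"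
  assumes "ideal I mpoly_ring"
  shows "mult_map I l (I +>\<^bsub>mpoly_ring\<^esub> f) = I +>\<^bsub>mpoly_ring\<^esub> (l * f)"
proof -
  interpret ideal I "mpoly_ring :: ('n, 'k) mpoly ring" by fact
  show ?thesis
    using rcoset_mult_add[of l f] by (simp add: mult_map_def FactRing_def)
qed

lemma zero_in_homogeneous_part: "0 \<in> homogeneous_part i"
  by (simp add: homogeneous_part_def)

text \<open>
  The weak Lefschetz property in terms of representatives: at each \<open>i\<close> below the top degree,
  multiplication by \<open>l\<close> is injective or surjective on the quotient.  The degree of the preimage
  \<open>f\<close> in the surjective case is dropped.
\<close>
lemma weak_LefschetzE:
  fixes I :: "('n::finite, 'k::field) mpoly set"
  assumes "weak_Lefschetz I" and I: "ideal I mpoly_ring"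
  obtains l where "l \<in> homogeneous_part 1"
    and "\<forall>i<top_degree I.
      (\<forall>f\<in>homogeneous_part i. l * f \<in> I \<longrightarrow> f \<in> I) \<or>
      (\<forall>g\<in>homogeneous_part (i + 1). \<exists>f. g - l * f \<in> I)"
proof -
  obtain l where l: "l \<in> homogeneous_part 1"
    and max: "\<And>i. i < top_degree I \<Longrightarrow> inj_on (mult_map I l) (quot_part I i) \<or>
        mult_map I l ` quot_part I i = quot_part I (i + 1)"
    using assms(1) unfolding weak_Lefschetz_def by (elim bexE) simp
  show thesis
  proof (rule that[OF l], intro allI impI)
    fix i assume "i < top_degree I"
    from max[OF this]
    show "(\<forall>f\<in>homogeneous_part i. l * f \<in> I \<longrightarrow> f \<in> I) \<or>
      (\<forall>g\<in>homogeneous_part (i + 1). \<exists>f. g - l * f \<in> I)"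
    proof
      assume inj: "inj_on (mult_map I l) (quot_part I i)"
      have "f \<in> I" if f: "f \<in> homogeneous_part i" and "l * f \<in> I" for f
      proof -
        have "mult_map I l (I +>\<^bsub>mpoly_ring\<^esub> f) = mult_map I l (I +>\<^bsub>mpoly_ring\<^esub> 0)"
          using that by (simp add: mult_map_coset[OF I] coset_eq_iff[OF I])
        then have "I +>\<^bsub>mpoly_ring\<^esub> f = I +>\<^bsub>mpoly_ring\<^esub> 0"
          by (rule inj_onD[OF inj]) (use f zero_in_homogeneous_part in \<open>auto simp: quot_part_def\<close>)
        then show ?thesis by (simp add: coset_eq_iff[OF I])
      qed
      then show ?thesis by (intro disjI1) simp
    next
      assume surj: "mult_map I l ` quot_part I i = quot_part I (i + 1)"
      have "\<exists>f. g - l * f \<in> I" if "g \<in> homogeneous_part (i + 1)" for g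
      proof -
        have "I +>\<^bsub>mpoly_ring\<^esub> g \<in> mult_map I l ` quot_part I i"
          unfolding surj using that by (simp add: quot_part_def)
        then obtain f where "I +>\<^bsub>mpoly_ring\<^esub> g = I +>\<^bsub>mpoly_ring\<^esub> (l * f)"
          by (auto simp: quot_part_def mult_map_coset[OF I])
        then show ?thesis by (auto simp: coset_eq_iff[OF I])
      qed
      then show ?thesis by (intro disjI2) simp
    qed
  qed
qed

text \<open>
  The second hypothesis makes the set of degrees in which the quotient is nonzero bounded, so that
  its greatest element exists.
\<close>
lemma top_degree_ge:
  fixes I :: "('n::finite, 'k::field) mpoly set"
  assumes I: "ideal I mpoly_ring"
    and bounded: "\<And>i. i > b \<Longrightarrow> homogeneous_part i \<subseteq> I"
    and g: "g \<in> homogeneous_part i" "g \<notin> I"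
  shows "i \<le> top_degree I"
  unfolding top_degree_def
proof (rule Greatest_le_nat)
  have zero: "\<zero>\<^bsub>mpoly_ring Quot I\<^esub> = I +>\<^bsub>mpoly_ring\<^esub> 0"
    by (simp add: FactRing_def coset_zero)
  have "I +>\<^bsub>mpoly_ring\<^esub> g \<noteq> I +>\<^bsub>mpoly_ring\<^esub> 0"
    using g by (simp add: coset_eq_iff[OF I])
  then show "quot_part I i \<noteq> {\<zero>\<^bsub>mpoly_ring Quot I\<^esub>}"
    using g(1) unfolding zero quot_part_def by blast
  fix j assume nz: "quot_part I j \<noteq> {\<zero>\<^bsub>mpoly_ring Quot I\<^esub>}"
  show "j \<le> b"
  proof (rule ccontr)
    assume "\<not> j \<le> b"
    then have "\<forall>f\<in>homogeneous_part j. I +>\<^bsub>mpoly_ring\<^esub> f = I +>\<^bsub>mpoly_ring\<^esub> 0"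
      using bounded[of j] by (auto simp: coset_eq_iff[OF I])
    then have "quot_part I j = {I +>\<^bsub>mpoly_ring\<^esub> 0}"
      using zero_in_homogeneous_part[of j] by (auto simp: quot_part_def)
    with nz zero show False by simp
  qed
qed

section \<open>Monomials and linear forms\<close>

lemma mon_deg_add: "mon_deg (m + m') = mon_deg m + mon_deg m'"
  by (simp add: mon_deg_def lookup_add sum.distrib)

lemma mon_deg_single [simp]: "mon_deg (Poly_Mapping.single i n) = n"
  by (simp add: mon_deg_def lookup_single when_def)

lemma single_exponent_inject:
  "Poly_Mapping.single i (Suc 0) = Poly_Mapping.single j (Suc 0) \<longleftrightarrow> i = j"
  by (metis One_nat_def lookup_single_eq lookup_single_not_eq zero_neq_one)

lemma mon_deg_eq_1E:
  assumes "mon_deg m = 1"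
  obtains i where "m = Poly_Mapping.single i 1"
proof -
  obtain i where i: "Poly_Mapping.lookup m i = 1"
    and others: "\<And>j. j \<noteq> i \<Longrightarrow> Poly_Mapping.lookup m j = 0"
    using assms sum_eq_1_iff[of UNIV "Poly_Mapping.lookup m"] by (auto simp: mon_deg_def)
  have "m = Poly_Mapping.single i 1"
    using i others by (intro poly_mapping_eqI) (auto simp: lookup_single when_def)
  then show thesis by (rule that)
qed

text \<open>The exponent vector of the squarefree monomial with support \<open>S\<close>.\<close>
definition squarefree_exponent :: "'n::finite set \<Rightarrow> 'n \<Rightarrow>\<^sub>0 nat" where
  "squarefree_exponent S = (\<Sum>i\<in>S. Poly_Mapping.single i 1)"

lemma lookup_squarefree_exponent:
  "Poly_Mapping.lookup (squarefree_exponent S) i = (if i \<in> S then 1 else 0)"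
  by (simp add: squarefree_exponent_def lookup_sum lookup_single when_def)

lemma mon_deg_squarefree_exponent [simp]: "mon_deg (squarefree_exponent S) = card S"
  by (simp add: mon_deg_def lookup_squarefree_exponent sum.If_cases)

lemma squarefree_mon_squarefree_exponent [simp]: "squarefree_mon (squarefree_exponent S)"
  by (simp add: squarefree_mon_def lookup_squarefree_exponent)

lemma squarefree_exponent_inject [simp]:
  "squarefree_exponent S = squarefree_exponent T \<longleftrightarrow> S = T"
proof
  assume "squarefree_exponent S = squarefree_exponent T"
  then have "Poly_Mapping.lookup (squarefree_exponent S) i =
      Poly_Mapping.lookup (squarefree_exponent T) i" for i by simp
  then show "S = T"
    unfolding lookup_squarefree_exponent by (metis subsetI subset_antisym zero_neq_one)
qed simp

lemma squarefree_exponent_remove: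
  assumes "i \<in> S"
  shows "squarefree_exponent S = Poly_Mapping.single i 1 + squarefree_exponent (S - {i})"
  using assms by (simp add: squarefree_exponent_def sum.remove)

lemma monomial_in_homogeneous_part: "monomial m \<in> homogeneous_part (mon_deg m)"
  by (simp add: monomial_def homogeneous_part_def)

lemma homogeneous_part_mult:
  assumes "f \<in> homogeneous_part i" "g \<in> homogeneous_part j"
  shows "f * g \<in> homogeneous_part (i + j)"
  unfolding homogeneous_part_def
proof (intro CollectI ballI)
  fix m assume "m \<in> Poly_Mapping.keys (f * g)"
  then obtain s t where "m = s + t" "s \<in> Poly_Mapping.keys f" "t \<in> Poly_Mapping.keys g"
    using keys_mult[of f g] by blast
  with assms show "mon_deg m = i + j"
    by (simp add: homogeneous_part_def mon_deg_add)
qed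

lemma homogeneous_part_power:
  assumes "f \<in> homogeneous_part 1"
  shows "f ^ n \<in> homogeneous_part n"
proof (induction n)
  case 0
  show ?case by (simp add: homogeneous_part_def mon_deg_def)
next
  case (Suc n)
  then show ?case using homogeneous_part_mult[OF assms Suc] by simp
qed

lemma indet_power: "indet i ^ n = Poly_Mapping.single (Poly_Mapping.single i n) 1"
  by (induction n) (simp_all add: indet_def monomial_def mult_single flip: single_add)

lemma linear_form_eq_sum:
  assumes "l \<in> homogeneous_part 1"
  shows "l = (\<Sum>i\<in>UNIV. Poly_Mapping.single 0 (Poly_Mapping.lookup l (Poly_Mapping.single i 1)) * indet i)"
proof (rule poly_mapping_eqI)
  fix m
  show "Poly_Mapping.lookup l m = Poly_Mapping.lookup (\<Sum>i\<in>UNIV.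
      Poly_Mapping.single 0 (Poly_Mapping.lookup l (Poly_Mapping.single i 1)) * indet i) m"
  proof (cases "\<exists>i. m = Poly_Mapping.single i 1")
    case True
    then show ?thesis
      by (auto simp: indet_def monomial_def mult_single lookup_sum lookup_single when_def
          single_exponent_inject)
  next
    case False
    then have "mon_deg m \<noteq> 1" using mon_deg_eq_1E[of m] by blast
    then have "Poly_Mapping.lookup l m = 0"
      using assms by (auto simp: homogeneous_part_def in_keys_iff)
    moreover have "Poly_Mapping.single i (Suc 0) \<noteq> m" for i
      using False by auto
    ultimately show ?thesis
      by (simp add: indet_def monomial_def mult_single lookup_sum lookup_single when_def)
  qed
qed

lemma lookup_single_mult_shift:
  fixes f :: "('n::finite, 'k::field) mpoly"
  shows "Poly_Mapping.lookup (Poly_Mapping.single t c * f) (t + m) = c * Poly_Mapping.lookup f m"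
proof -
  have "Poly_Mapping.lookup (Poly_Mapping.single t c * f) (t + m) =
      (\<Sum>q. (c * Poly_Mapping.lookup f q) when m = q)"
    by (simp add: lookup_mult lookup_single when_mult mult_when)
  then show ?thesis by simp
qed

lemma lookup_indet_mult_squarefree:
  fixes f :: "('n::finite, 'k::field) mpoly"
  shows "Poly_Mapping.lookup (Poly_Mapping.single 0 c * indet i * f) (squarefree_exponent S) =
    (if i \<in> S then c * Poly_Mapping.lookup f (squarefree_exponent (S - {i})) else 0)"
proof -
  have eq: "Poly_Mapping.single 0 c * indet i = (Poly_Mapping.single (Poly_Mapping.single i 1) c :: ('n, 'k) mpoly)"
    by (simp add: indet_def monomial_def mult_single)
  show ?thesis
  proof (cases "i \<in> S")
    case True
    then show ?thesis
      using lookup_single_mult_shift[of "Poly_Mapping.single i 1" c f "squarefree_exponent (S - {i})"]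
      by (simp only: eq squarefree_exponent_remove[OF True] if_True)
  next
    case False
    have "squarefree_exponent S \<notin>
        Poly_Mapping.keys (Poly_Mapping.single (Poly_Mapping.single i 1) c * f)"
    proof
      assume "squarefree_exponent S \<in>
        Poly_Mapping.keys (Poly_Mapping.single (Poly_Mapping.single i 1) c * f)"
      then obtain s t where "squarefree_exponent S = s + t"
        and s: "s \<in> Poly_Mapping.keys (Poly_Mapping.single (Poly_Mapping.single i 1) c)"
        using keys_mult[of "Poly_Mapping.single (Poly_Mapping.single i 1) c" f] by blast
      moreover from s have "s = Poly_Mapping.single i 1"
        by (cases "c = 0") simp_all
      ultimately have "Poly_Mapping.lookup (squarefree_exponent S) i \<ge> 1"
        by (simp add: lookup_add)
      with False show False by (simp add: lookup_squarefree_exponent)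
    qed
    with False show ?thesis
      by (simp only: eq in_keys_iff if_False) simp
  qed
qed

lemma lookup_linear_form_mult_squarefree:
  fixes l f :: "('n::finite, 'k::field) mpoly"
  assumes "l \<in> homogeneous_part 1"
  shows "Poly_Mapping.lookup (l * f) (squarefree_exponent S) =
    (\<Sum>i\<in>S. Poly_Mapping.lookup l (Poly_Mapping.single i 1) *
      Poly_Mapping.lookup f (squarefree_exponent (S - {i})))"
proof -
  let ?a = "\<lambda>i. Poly_Mapping.lookup l (Poly_Mapping.single i 1)"
  have "l * f = (\<Sum>i\<in>UNIV. Poly_Mapping.single 0 (?a i) * indet i * f)"
    using arg_cong[OF linear_form_eq_sum[OF assms], of "\<lambda>g. g * f"]
    by (simp only: sum_distrib_right)
  then show ?thesis
    by (simp only: lookup_sum lookup_indet_mult_squarefree) (simp add: sum.If_cases)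
qed

section \<open>The ideal generated by powers and squarefree monomials\<close>

lemma ideal_powers_squarefree:
  "ideal (powers_squarefree_ideal \<alpha> d :: ('n::finite, 'k::field) mpoly set) mpoly_ring"
proof -
  interpret ring "mpoly_ring :: ('n, 'k) mpoly ring" ..
  show ?thesis
    unfolding powers_squarefree_ideal_def by (rule genideal_ideal) simp
qed

lemma powers_squarefree_ideal_mult:
  fixes f g :: "('n::finite, 'k::field) mpoly"
  assumes "f \<in> powers_squarefree_ideal \<alpha> d"
  shows "g * f \<in> powers_squarefree_ideal \<alpha> d"
  using ideal.I_l_closed[OF ideal_powers_squarefree assms, of g] by simp

lemma powers_squarefree_ideal_sum:
  fixes f :: "'a \<Rightarrow> ('n::finite, 'k::field) mpoly"
  assumes "\<And>x. x \<in> B \<Longrightarrow> f x \<in> powers_squarefree_ideal \<alpha> d"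
  shows "sum f B \<in> powers_squarefree_ideal \<alpha> d"
proof -
  note I = ideal.axioms(1)[OF ideal_powers_squarefree[of \<alpha> d, where ?'k = 'k]]
  have "(0 :: ('n, 'k) mpoly) \<in> powers_squarefree_ideal \<alpha> d"
    using additive_subgroup.zero_closed[OF I] by simp
  moreover have "g + h \<in> powers_squarefree_ideal \<alpha> d"
    if "g \<in> powers_squarefree_ideal \<alpha> d" "h \<in> powers_squarefree_ideal \<alpha> d"
    for g h :: "('n, 'k) mpoly"
    using additive_subgroup.a_closed[OF I that] by simp
  ultimately show ?thesis
    using assms by (induction B rule: infinite_finite_induct) auto
qed

lemma indet_power_in_ideal:
  assumes "\<alpha> i \<le> n"
  shows "(indet i ^ n :: ('n::finite, 'k::field) mpoly) \<in> powers_squarefree_ideal \<alpha> d"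
proof -
  interpret ring "mpoly_ring :: ('n, 'k) mpoly ring" ..
  have "(indet i ^ \<alpha> i :: ('n, 'k) mpoly) \<in> powers_squarefree_ideal \<alpha> d"
    unfolding powers_squarefree_ideal_def by (rule subsetD[OF genideal_self]) auto
  from powers_squarefree_ideal_mult[OF this, of "indet i ^ (n - \<alpha> i)"]
  show ?thesis using assms by (simp flip: power_add)
qed

text \<open>
  The polynomials without squarefree monomials of degree less than \<open>d\<close> form an ideal
  that contains the generators, because all exponents \<open>\<alpha> i\<close> are at least 2.
\<close>
lemma lookup_squarefree_of_ideal:
  fixes f :: "('n::finite, 'k::field) mpoly"
  assumes "f \<in> powers_squarefree_ideal \<alpha> d" and "\<And>i. 2 \<le> \<alpha> i" and "card S < d"
  shows "Poly_Mapping.lookup f (squarefree_exponent S) = 0"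
proof -
  interpret ring "mpoly_ring :: ('n, 'k) mpoly ring" ..
  define J :: "('n, 'k) mpoly set"
    where "J = {f. \<forall>m\<in>Poly_Mapping.keys f. squarefree_mon m \<longrightarrow> d \<le> mon_deg m}"
  have mult: "g * f \<in> J" if "f \<in> J" for f g
    unfolding J_def
  proof (intro CollectI ballI impI)
    fix m assume "m \<in> Poly_Mapping.keys (g * f)" and m: "squarefree_mon m"
    then obtain s t where st: "m = s + t" "t \<in> Poly_Mapping.keys f"
      using keys_mult[of g f] by blast
    have "Poly_Mapping.lookup t i \<le> Poly_Mapping.lookup m i" for i
      by (simp add: st(1) lookup_add)
    then have "squarefree_mon t"
      using m unfolding squarefree_mon_def by (meson order_trans)
    with that st show "d \<le> mon_deg m"
      by (simp add: J_def mon_deg_add trans_le_add2)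
  qed
  have "ideal J mpoly_ring"
  proof (rule idealI)
    show "subgroup J (add_monoid mpoly_ring)"
    proof (rule add.subgroupI)
      show "J \<noteq> {}" by (auto simp: J_def intro!: exI[of _ 0])
      show "\<ominus>\<^bsub>mpoly_ring\<^esub> f \<in> J" if "f \<in> J" for f
        using mult[OF that, of "- 1"] by simp
      show "f \<oplus>\<^bsub>mpoly_ring\<^esub> g \<in> J" if "f \<in> J" "g \<in> J" for f g
        using that keys_add[of f g] by (fastforce simp: J_def)
    qed simp
  qed (use mult in \<open>auto simp: ring_axioms mult.commute\<close>)
  moreover have "indet i ^ \<alpha> i \<in> J" for i
  proof -
    have "\<not> squarefree_mon (Poly_Mapping.single i (\<alpha> i))"
      using assms(2)[of i] by (auto simp: squarefree_mon_def intro!: exI[of _ i])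
    then show ?thesis by (simp add: J_def indet_power)
  qed
  moreover have "monomial m \<in> J" if "mon_deg m = d" for m
    using that by (simp add: J_def monomial_def)
  ultimately have "powers_squarefree_ideal \<alpha> d \<subseteq> J"
    unfolding powers_squarefree_ideal_def by (intro genideal_minimal) auto
  with assms(1) have "f \<in> J" by blast
  then have "squarefree_exponent S \<notin> Poly_Mapping.keys f"
    using assms(3) by (auto simp: J_def)
  then show ?thesis by (simp add: in_keys_iff)
qed

text \<open>By the pigeonhole principle, every monomial of degree \<open>n\<close> is divisible by some \<open>x\<^sub>i\<^sup>b\<close>.\<close>
lemma homogeneous_part_subset_ideal:
  assumes \<alpha>: "\<And>i. \<alpha> i \<le> b" and n: "CARD('n) * b < n"
  shows "(homogeneous_part n :: ('n::finite, 'k::field) mpoly set) \<subseteq> powers_squarefree_ideal \<alpha> d"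
proof
  fix f :: "('n, 'k) mpoly"
  assume f: "f \<in> homogeneous_part n"
  have "Poly_Mapping.single m c \<in> powers_squarefree_ideal \<alpha> d" if "mon_deg m = n" for m and c :: 'k
  proof -
    obtain i where i: "b \<le> Poly_Mapping.lookup m i"
    proof (rule ccontr)
      assume "\<not> thesis"
      with that have "Poly_Mapping.lookup m i \<le> b" for i by (meson nle_le)
      then have "mon_deg m \<le> CARD('n) * b"
        using sum_bounded_above[of UNIV "Poly_Mapping.lookup m" b] by (simp add: mon_deg_def)
      with \<open>mon_deg m = n\<close> n show False by simp
    qed
    have "m = (m - Poly_Mapping.single i b) + Poly_Mapping.single i b"
      using i by (intro poly_mapping_eqI) (auto simp: lookup_add lookup_minus lookup_single when_def)
    then have "Poly_Mapping.single m c = Poly_Mapping.single (m - Poly_Mapping.single i b) c * indet i ^ b"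
      by (simp add: indet_power mult_single)
    then show ?thesis
      by (simp add: powers_squarefree_ideal_mult indet_power_in_ideal \<alpha>)
  qed
  then have "(\<Sum>m\<in>Poly_Mapping.keys f. Poly_Mapping.single m (Poly_Mapping.lookup f m))
      \<in> powers_squarefree_ideal \<alpha> d"
    using f by (intro powers_squarefree_ideal_sum) (auto simp: homogeneous_part_def)
  moreover have "(\<Sum>m\<in>Poly_Mapping.keys f. Poly_Mapping.single m (Poly_Mapping.lookup f m)) = f"
    by (intro poly_mapping_eqI)
      (auto simp: lookup_sum lookup_single when_def in_keys_iff)
  ultimately show "f \<in> powers_squarefree_ideal \<alpha> d" by simp
qed

section \<open>Multiplication by a linear form in characteristic 2\<close>

lemma linear_form_power4_in_ideal:
  fixes l :: "('n::finite, 'k::field) mpoly"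
  assumes char: "CHAR('k) = 2" and \<alpha>: "\<And>i. \<alpha> i \<le> 4" and l: "l \<in> homogeneous_part 1"
  shows "l ^ 4 \<in> powers_squarefree_ideal \<alpha> d"
proof -
  have char': "CHAR(('n, 'k) mpoly) = 2"
  proof (rule CHAR_eqI)
    have of_nat: "of_nat n = (Poly_Mapping.single 0 (of_nat n) :: ('n, 'k) mpoly)" for n
      by (rule single_of_nat[symmetric])
    show "of_nat 2 = (0 :: ('n, 'k) mpoly)"
      using of_nat_CHAR[where ?'a = 'k] unfolding char of_nat by simp
    fix n assume "of_nat n = (0 :: ('n, 'k) mpoly)"
    then have "Poly_Mapping.lookup (of_nat n :: ('n, 'k) mpoly) 0 = 0" by simp
    then have "of_nat n = (0 :: 'k)" by (simp add: lookup_of_nat)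
    then show "2 dvd n" by (simp add: of_nat_eq_0_iff_char_dvd char)
  qed
  let ?c = "\<lambda>i. Poly_Mapping.single 0 (Poly_Mapping.lookup l (Poly_Mapping.single i 1)) :: ('n, 'k) mpoly"
  have "l ^ 4 = (\<Sum>i\<in>UNIV. ?c i * indet i) ^ 4"
    using linear_form_eq_sum[OF l] by simp
  also have "\<dots> = (\<Sum>i\<in>UNIV. (?c i * indet i) ^ 4)"
    by (rule freshmans_dream_sum'[where n = 2]) (simp_all add: char')
  also have "\<dots> = (\<Sum>i\<in>UNIV. ?c i ^ 4 * indet i ^ 4)"
    by (simp add: power_mult_distrib)
  also have "\<dots> \<in> powers_squarefree_ideal \<alpha> d"
    by (intro powers_squarefree_ideal_sum powers_squarefree_ideal_mult indet_power_in_ideal \<alpha>)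
  finally show ?thesis .
qed

lemma sum_off_diagonal_char_2:
  fixes h :: "'a \<Rightarrow> 'a \<Rightarrow> 'k::field"
  assumes "CHAR('k) = 2" and "finite U" and sym: "\<And>u v. h u v = h v u"
  shows "(\<Sum>u\<in>U. \<Sum>v\<in>U - {u}. h u v) = 0"
  using \<open>finite U\<close>
proof induction
  case (insert w U)
  have two: "x + x = 0" for x :: 'k
    using of_nat_CHAR[where ?'a = 'k] assms(1) by (simp flip: mult_2)
  have "(\<Sum>u\<in>insert w U. \<Sum>v\<in>insert w U - {u}. h u v)
      = (\<Sum>v\<in>U. h w v) + (\<Sum>u\<in>U. \<Sum>v\<in>insert w U - {u}. h u v)"
    using insert.hyps by simp
  also have "(\<Sum>u\<in>U. \<Sum>v\<in>insert w U - {u}. h u v) = (\<Sum>u\<in>U. h u w + (\<Sum>v\<in>U - {u}. h u v))"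
  proof (rule sum.cong)
    fix u assume "u \<in> U"
    then have "insert w U - {u} = insert w (U - {u})" using insert.hyps by auto
    then show "(\<Sum>v\<in>insert w U - {u}. h u v) = h u w + (\<Sum>v\<in>U - {u}. h u v)"
      using insert.hyps by simp
  qed simp
  also have "\<dots> = (\<Sum>v\<in>U. h w v)"
    by (simp add: sum.distrib insert.IH sym[of w])
  finally show ?case by (simp add: two)
qed simp

text \<open>
  In the quotient, the squarefree monomial with support \<open>S\<close> is not a multiple of \<open>l\<close>.  The functional
  \<open>\<Phi>\<close> below vanishes on the ideal and on all multiples of \<open>l\<close>, but not on that monomial.
\<close>
lemma multiplication_not_surjective:
  fixes l :: "('n::finite, 'k::field) mpoly"
  assumes char: "CHAR('k) = 2" and \<alpha>: "\<And>i. 2 \<le> \<alpha> i" and l: "l \<in> homogeneous_part 1"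
    and j: "j < d" "j < CARD('n)"
  obtains S where "card S = j"
    and "\<forall>f. monomial (squarefree_exponent S) - l * f \<notin> powers_squarefree_ideal \<alpha> d"
proof (cases "\<exists>w. Poly_Mapping.lookup l (Poly_Mapping.single w 1) \<noteq> 0")
  case False
  then have "l = 0"
    using linear_form_eq_sum[OF l] by simp
  moreover obtain S :: "'n set" where S: "card S = j"
    using obtain_subset_with_card_n[of j "UNIV :: 'n set"] j by auto
  moreover have "Poly_Mapping.lookup (monomial (squarefree_exponent S) :: ('n, 'k) mpoly)
      (squarefree_exponent S) \<noteq> 0"
    by (simp add: monomial_def)
  ultimately show thesis
    using that[of S] lookup_squarefree_of_ideal[of _ \<alpha> d S] \<alpha> j by auto
next
  case True
  define a where "a i = Poly_Mapping.lookup l (Poly_Mapping.single i 1)" for i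
  from True obtain w where w: "a w \<noteq> 0" by (auto simp: a_def)
  have "j \<le> card (UNIV - {w})" using j by simp
  then obtain S where S: "S \<subseteq> UNIV - {w}" "card S = j"
    by (rule obtain_subset_with_card_n)
  define U where "U = insert w S"
  \<comment> \<open>Every monomial read by \<open>\<Phi>\<close> has degree \<open>j < d\<close>.\<close>
  have card: "card (U - {u}) = j" if "u \<in> U" for u
    using that S by (auto simp: U_def card_insert_if card_Diff_singleton)
  have S_eq: "U - {w} = S" using S by (auto simp: U_def)
  define \<Phi> where "\<Phi> g = (\<Sum>u\<in>U. a u * Poly_Mapping.lookup g (squarefree_exponent (U - {u})))"
    for g :: "('n, 'k) mpoly"
  have ideal: "\<Phi> g = 0" if "g \<in> powers_squarefree_ideal \<alpha> d" for g
    using lookup_squarefree_of_ideal[OF that \<alpha>] card j by (simp add: \<Phi>_def)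
  have multiple: "\<Phi> (l * f) = 0" for f
  proof -
    have remove_two: "U - {u, v} = U - {u} - {v}" for u v by auto
    define h where "h u v = a u * a v * Poly_Mapping.lookup f (squarefree_exponent (U - {u, v}))"
      for u v
    have "\<Phi> (l * f) = (\<Sum>u\<in>U. \<Sum>v\<in>U - {u}. h u v)"
      unfolding \<Phi>_def lookup_linear_form_mult_squarefree[OF l] h_def a_def[symmetric]
        sum_distrib_left mult.assoc remove_two ..
    also have "\<dots> = 0"
    proof (rule sum_off_diagonal_char_2[OF char])
      show "h u v = h v u" for u v
        unfolding h_def insert_commute[of u v "{}"] by simp
    qed simp
    finally show ?thesis .
  qed
  have "\<Phi> (monomial (squarefree_exponent S)) = (\<Sum>u\<in>U. if u = w then a u else 0)"
    unfolding \<Phi>_def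
  proof (rule sum.cong[OF refl])
    fix u assume "u \<in> U"
    then have "S = U - {u} \<longleftrightarrow> u = w"
      using S by (auto simp: U_def)
    then show "a u * Poly_Mapping.lookup (monomial (squarefree_exponent S)) (squarefree_exponent (U - {u}))
        = (if u = w then a u else 0)"
      by (simp only: monomial_def lookup_single when_def squarefree_exponent_inject) simp
  qed
  also have "\<dots> = a w"
    by (simp add: sum.delta' U_def)
  finally have nonzero: "\<Phi> (monomial (squarefree_exponent S)) \<noteq> 0"
    using w by simp
  have diff: "\<Phi> (f - g) = \<Phi> f - \<Phi> g" for f g
    by (simp add: \<Phi>_def lookup_minus algebra_simps sum_subtractf)
  have "monomial (squarefree_exponent S) - l * f \<notin> powers_squarefree_ideal \<alpha> d" for f
    using ideal[of "monomial (squarefree_exponent S) - l * f"] nonzero by (auto simp: diff multiple)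
  then show thesis using that S by blast
qed

section \<open>Failure of the weak Lefschetz property\<close>

theorem theoremB:
  fixes \<alpha> :: "'n::finite \<Rightarrow> nat" and d :: nat
  assumes "infinite (UNIV :: 'k::field set)"
    and "CHAR('k) = 2"
    and "5 \<le> d" and "d \<le> CARD('n)"
    and "\<And>i. 2 \<le> \<alpha> i \<and> \<alpha> i \<le> 4"
  shows "\<not> weak_Lefschetz (powers_squarefree_ideal \<alpha> d :: ('n, 'k) mpoly set)"
proof
  let ?I = "powers_squarefree_ideal \<alpha> d :: ('n, 'k) mpoly set"
  have \<alpha>: "\<And>i. 2 \<le> \<alpha> i" "\<And>i. \<alpha> i \<le> 4" using assms(5) by auto
  note I = ideal_powers_squarefree[of \<alpha> d, where ?'k = 'k]
  have squarefree_notin: "(monomial (squarefree_exponent S) :: ('n, 'k) mpoly) \<notin> ?I"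
    if "card S < d" for S
    using lookup_squarefree_of_ideal[OF _ \<alpha>(1) that, of "monomial (squarefree_exponent S) :: ('n, 'k) mpoly"]
    by (auto simp: monomial_def)
  obtain S :: "'n set" where S: "card S = 4"
    using obtain_subset_with_card_n[of 4 "UNIV :: 'n set"] assms(3,4) by auto
  have top: "4 \<le> top_degree ?I"
  proof (rule top_degree_ge[OF I])
    show "homogeneous_part i \<subseteq> ?I" if "i > CARD('n) * 4" for i
      by (rule homogeneous_part_subset_ideal[OF \<alpha>(2) that])
    show "(monomial (squarefree_exponent S) :: ('n, 'k) mpoly) \<in> homogeneous_part 4"
      using monomial_in_homogeneous_part[of "squarefree_exponent S"] S by simp
    show "(monomial (squarefree_exponent S) :: ('n, 'k) mpoly) \<notin> ?I"
      using squarefree_notin[of S] S assms(3) by simp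
  qed
  assume "weak_Lefschetz ?I"
  then obtain l where l: "l \<in> homogeneous_part 1"
    and max_rank: "\<forall>i<top_degree ?I.
      (\<forall>f\<in>homogeneous_part i. l * f \<in> ?I \<longrightarrow> f \<in> ?I) \<or>
      (\<forall>g\<in>homogeneous_part (i + 1). \<exists>f. g - l * f \<in> ?I)"
    using I by (rule weak_LefschetzE)
  \<comment> \<open>Not being surjective, the map is injective in degree \<open>i\<close>, so \<open>l\<close> can be cancelled.\<close>
  have descend: "l ^ i \<in> ?I" if "l ^ (i + 1) \<in> ?I" and "i < 4" for i
  proof -
    obtain S where S: "card S = i + 1"
      "\<forall>f. monomial (squarefree_exponent S) - l * f \<notin> ?I"
    proof (rule multiplication_not_surjective[where \<alpha> = \<alpha>, OF assms(2) \<alpha>(1) l])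
      show "i + 1 < d" "i + 1 < CARD('n)" using \<open>i < 4\<close> assms(3,4) by simp_all
    qed
    have "monomial (squarefree_exponent S) \<in> homogeneous_part (i + 1)"
      using monomial_in_homogeneous_part[of "squarefree_exponent S"] S(1) by simp
    then have "\<not> (\<forall>g\<in>homogeneous_part (i + 1). \<exists>f. g - l * f \<in> ?I)"
      using S(2) by blast
    moreover have "i < top_degree ?I"
      using top \<open>i < 4\<close> by simp
    ultimately have "\<forall>f\<in>homogeneous_part i. l * f \<in> ?I \<longrightarrow> f \<in> ?I"
      using max_rank by blast
    then show ?thesis
      using homogeneous_part_power[OF l] that(1) by simp
  qed
  have "l ^ 4 \<in> ?I"
    by (rule linear_form_power4_in_ideal[OF assms(2) \<alpha>(2) l])
  then have "l ^ 0 \<in> ?I"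
    using descend[of 0] descend[of 1] descend[of 2] descend[of 3] by (simp add: power2_eq_square)
  moreover have "l ^ 0 = monomial (squarefree_exponent {})"
    by (simp add: monomial_def squarefree_exponent_def)
  ultimately show False
    using squarefree_notin[of "{}"] assms(3) by simp
qed

end
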